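(* Let $X$ be a finite-dimensional, strictly convex and smooth real Banach space with closed unit ball $B_X$, and let $M, N\subset X$ be linear subspaces. If there are $z\in M\cap N$ and $\varepsilon>0$ such that $R_{M,N}x=P_{M\cap N}x$ for all $x \in z + \varepsilon B_X$, then $R_{M,N}x = P_{M\cap N}x$ for all $x\in X$.
   Context: For a finite-dimensional strictly convex Banach space $X$ and a linear subspace $L\subset X$, the metric projection $P_L\colon X\to X$ sends $x$ to the unique point $P_Lx\in L$ with $\|x-P_Lx\|=d(x,L)$; it is in general nonlinear. When $X$ is finite-dimensional, strictly convex and smooth (the norm is Gâteaux differentiable away from the origin), the alternating projections converge pointwise, and one defines $R_{M,N}x:=\lim_{n\to\infty}(P_MP_N)^nx$ for $x\in X$; the limit lies in $M\cap N$. *)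

theory Defs
  imports "HOL-Analysis.Analysis"
begin

text \<open>The Banach space is the whole of a type; its geometric properties are predicates on that type.\<close>

definition finite_dimensional_space :: "'a::real_normed_vector itself \<Rightarrow> bool" where
  "finite_dimensional_space _ \<longleftrightarrow>
     (\<exists>B. finite_dimensional_vector_space (scaleR :: real \<Rightarrow> 'a \<Rightarrow> 'a) B)"

definition strictly_convex_space :: "'a::real_normed_vector itself \<Rightarrow> bool" where
  "strictly_convex_space _ \<longleftrightarrow>
     (\<forall>x y :: 'a. norm x = 1 \<and> norm y = 1 \<and> x \<noteq> y \<longrightarrow> norm ((1/2) *\<^sub>R (x + y)) < 1)"

definition gateaux_differentiable_at :: "('a::real_normed_vector \<Rightarrow> real) \<Rightarrow> 'a \<Rightarrow> bool" where
  "gateaux_differentiable_at f x \<longleftrightarrow>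
     (\<exists>D. bounded_linear D \<and>
        (\<forall>h. ((\<lambda>t::real. (f (x + t *\<^sub>R h) - f x) / t) \<longlongrightarrow> D h) (at 0)))"

definition smooth_space :: "'a::real_normed_vector itself \<Rightarrow> bool" where
  "smooth_space _ \<longleftrightarrow> (\<forall>x :: 'a. x \<noteq> 0 \<longrightarrow> gateaux_differentiable_at norm x)"

text \<open>The nearest point exists and is unique for linear subspaces of finite-dimensional
  strictly convex spaces; elsewhere the value is unspecified.\<close>

definition metric_projection :: "'a::real_normed_vector set \<Rightarrow> 'a \<Rightarrow> 'a" where
  "metric_projection L x = (THE y. y \<in> L \<and> norm (x - y) = infdist x L)"

text \<open>The limit exists for linear subspaces of finite-dimensional, strictly convex and smooth
  spaces; elsewhere the value may be meaningless.\<close>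

definition alternating_limit :: "'a::real_normed_vector set \<Rightarrow> 'a set \<Rightarrow> 'a \<Rightarrow> 'a" where
  "alternating_limit M N x =
     lim (\<lambda>n. ((metric_projection M \<circ> metric_projection N) ^^ n) x)"

end

theory Submission
  imports Defs
begin

text \<open>
  A metric projection onto a subspace \<open>L\<close> is nonlinear, but it commutes with every map
  \<open>x \<mapsto> z + t x\<close> with \<open>z \<in> L\<close> and \<open>t > 0\<close>, because such a map permutes \<open>L\<close> and scales all
  distances by \<open>t\<close> (\<open>metric_projection_affine\<close>). For \<open>z \<in> M \<inter> N\<close> the same therefore holds for
  \<open>P\<^sub>M\<close>, for \<open>P\<^sub>N\<close>, for all iterates of \<open>P\<^sub>M P\<^sub>N\<close>, and for \<open>P\<close> on \<open>M \<inter> N\<close>. Given any \<open>x\<close>, the point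
  \<open>z + t x\<close> lies in the ball around \<open>z\<close> once \<open>t\<close> is small; there the limit agrees with the
  projection, and cancelling \<open>z\<close> and \<open>t\<close> transports the equality back to \<open>x\<close>.

  The cancellation on the side of the limit presupposes that the orbit of \<open>x\<close> converges. If it
  does not, no orbit of a point \<open>z' + t x\<close> with \<open>z' \<in> M \<inter> N\<close> converges either, and \<open>lim\<close> takes the
  same default value \<open>c\<close> at all these points. The hypothesis then makes the projection constant
  on those of them that lie in the ball, whereas its value there is \<open>z' + t P x\<close>. Varying \<open>t\<close>
  and \<open>z'\<close> forces \<open>P x = 0\<close> and \<open>z = 0\<close>, hence \<open>c = 0 = P x\<close>, so the equality holds at \<open>x\<close> in
  this case as well.

  Equivariance of \<open>P\<^sub>L\<close> rests on existence and uniqueness of nearest points: existence by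
  compactness of bounded closed pieces of finite-dimensional subspaces, uniqueness by strict
  convexity.
\<close>

section \<open>Nearest points in finite-dimensional subspaces\<close>

lemma nearest_point_exists:
  fixes x :: "'a::real_normed_vector"
  assumes "0 \<in> L" and "\<And>r. compact (cball 0 r \<inter> L)"
  obtains y where "y \<in> L" "\<And>w. w \<in> L \<Longrightarrow> norm (x - y) \<le> norm (x - w)"
proof -
  \<comment> \<open>Points of norm above \<open>2 * norm x\<close> are farther from \<open>x\<close> than the competitor \<open>0\<close>.\<close>
  let ?K = "cball 0 (2 * norm x) \<inter> L"
  have "0 \<in> ?K"
    using assms(1) by simp
  moreover have "continuous_on ?K (\<lambda>y. norm (x - y))"
    by (intro continuous_intros)
  ultimately obtain y where y: "y \<in> ?K" "\<And>w. w \<in> ?K \<Longrightarrow> norm (x - y) \<le> norm (x - w)"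
    using continuous_attains_inf[OF assms(2), of "2 * norm x" "\<lambda>y. norm (x - y)"] by blast
  have "norm (x - y) \<le> norm (x - w)" if "w \<in> L" for w
  proof (cases "w \<in> ?K")
    case False
    then have "norm w > 2 * norm x"
      using that by simp
    then have "norm x \<le> norm (x - w)"
      using norm_triangle_ineq2[of w x] by (simp add: norm_minus_commute)
    moreover have "norm (x - y) \<le> norm x"
      using y(2)[OF \<open>0 \<in> ?K\<close>] by simp
    ultimately show ?thesis
      by simp
  qed (use y in blast)
  with y(1) show thesis
    using that by blast
qed

text \<open>Adjoin a vector \<open>b\<close> to a subspace \<open>L\<close> not containing it. In the resulting space, the
  coefficient of \<open>b\<close> in \<open>y\<close> is at most \<open>norm y\<close> divided by the distance from \<open>b\<close> to \<open>L\<close>.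
  Thus a ball of the larger space is cut out of the continuous image of a product of an interval
  and a ball of \<open>L\<close>. The distance is positive because it is attained, by
  \<open>nearest_point_exists\<close>.\<close>

lemma compact_cball_Int_span:
  fixes B :: "'a::real_normed_vector set"
  assumes "finite B"
  shows "compact (cball 0 r \<inter> span B)"
  using assms
proof (induction B arbitrary: r rule: finite_induct)
  case empty
  have "cball 0 r \<inter> span {} = (if r \<ge> 0 then {0::'a} else {})"
    by auto
  then show ?case
    by simp
next
  case (insert b B)
  show ?case
  proof (cases "b \<in> span B")
    case True
    then show ?thesis
      using insert.IH by (simp add: span_redundant)
  next
    case False
    obtain p where p: "p \<in> span B" "\<And>w. w \<in> span B \<Longrightarrow> norm (b - p) \<le> norm (b - w)"
      using nearest_point_exists[OF span_zero insert.IH] by blast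
    define d where "d = norm (b - p)"
    have "d > 0"
      using p(1) False by (auto simp: d_def)
    have coeff: "\<bar>t\<bar> * d \<le> norm (l + t *\<^sub>R b)" if "l \<in> span B" for l t
    proof (cases "t = 0")
      case False
      have "d \<le> norm (b - (- inverse t) *\<^sub>R l)"
        unfolding d_def using p(2) that span_scale by blast
      then have "\<bar>t\<bar> * d \<le> norm (t *\<^sub>R (b - (- inverse t) *\<^sub>R l))"
        by (simp add: mult_left_mono)
      also have "t *\<^sub>R (b - (- inverse t) *\<^sub>R l) = l + t *\<^sub>R b"
        using False by (simp add: algebra_simps)
      finally show ?thesis .
    qed simp
    let ?T = "{- (r / d)..r / d}" and ?L = "cball 0 (r + r / d * norm b) \<inter> span B"
    let ?K = "(\<lambda>(t, l). l + t *\<^sub>R b) ` (?T \<times> ?L)"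
    have "compact ?K"
      by (intro compact_continuous_image compact_Times insert.IH)
        (auto simp: case_prod_unfold intro!: continuous_intros)
    moreover have "cball 0 r \<inter> span (insert b B) = cball 0 r \<inter> ?K"
    proof (intro set_eqI iffI)
      fix y assume "y \<in> cball 0 r \<inter> span (insert b B)"
      then obtain t where y: "norm y \<le> r" and l: "y - t *\<^sub>R b \<in> span B"
        using span_breakdown_eq[of y b B] by auto
      have "\<bar>t\<bar> * d \<le> r"
        using coeff[OF l, of t] y by simp
      then have t: "\<bar>t\<bar> \<le> r / d"
        using \<open>d > 0\<close> by (simp add: field_simps)
      have "norm (t *\<^sub>R b) \<le> r / d * norm b"
        using mult_right_mono[OF t norm_ge_zero[of b]] by simp
      then have "norm (y - t *\<^sub>R b) \<le> r + r / d * norm b"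
        using norm_triangle_ineq4[of y "t *\<^sub>R b"] y by linarith
      then have "(t, y - t *\<^sub>R b) \<in> ?T \<times> ?L"
        using t l by auto
      then have "y \<in> ?K"
        by (rule rev_image_eqI) simp
      then show "y \<in> cball 0 r \<inter> ?K"
        using y by simp
    next
      fix y assume "y \<in> cball 0 r \<inter> ?K"
      then show "y \<in> cball 0 r \<inter> span (insert b B)"
        by (auto intro!: span_add span_scale intro: span_base span_mono[THEN subsetD, OF subset_insertI])
    qed
    ultimately show ?thesis
      by (simp add: closed_Int_compact)
  qed
qed

lemma finite_dimensional_subspace_span:
  fixes L :: "'a::real_normed_vector set"
  assumes "finite_dimensional_space TYPE('a)" and "subspace L"
  obtains C where "finite C" "L = span C"
proof -
  obtain B where "finite_dimensional_vector_space (scaleR :: real \<Rightarrow> 'a \<Rightarrow> 'a) B"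
    using assms(1) unfolding finite_dimensional_space_def by blast
  then interpret fd: finite_dimensional_vector_space "scaleR :: real \<Rightarrow> 'a \<Rightarrow> 'a" B .
  have "span B = (UNIV :: 'a set)"
    using fd.span_Basis by (simp add: span_raw_def)
  obtain C where C: "C \<subseteq> L" "independent C" "L \<subseteq> span C"
    using maximal_independent_subset by blast
  have "finite C"
    using independent_span_bound[OF fd.finite_Basis C(2)] \<open>span B = UNIV\<close> by simp
  moreover have "L = span C"
    using C(1,3) assms(2) span_minimal by blast
  ultimately show thesis
    using that by blast
qed

text \<open>If two distinct points of \<open>L\<close> had the same minimal distance from \<open>x\<close>, then by strict convexity
  their midpoint would be closer.\<close>

lemma nearest_point_unique:
  fixes x :: "'a::real_normed_vector"
  assumes "strictly_convex_space TYPE('a)" and "subspace L"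
    and y: "y \<in> L" "\<And>w. w \<in> L \<Longrightarrow> norm (x - y) \<le> norm (x - w)"
    and y': "y' \<in> L" "\<And>w. w \<in> L \<Longrightarrow> norm (x - y') \<le> norm (x - w)"
  shows "y = y'"
proof (rule ccontr)
  assume "y \<noteq> y'"
  define d where "d = norm (x - y)"
  have d': "norm (x - y') = d"
    unfolding d_def using y y' by (meson antisym)
  have "d > 0"
    using d' \<open>y \<noteq> y'\<close> by (auto simp: d_def)
  let ?u = "(1 / d) *\<^sub>R (x - y)" and ?v = "(1 / d) *\<^sub>R (x - y')"
  define m where "m = (1 / 2) *\<^sub>R (y + y')"
  have "norm ?u = 1" "norm ?v = 1" "?u \<noteq> ?v"
    using \<open>d > 0\<close> d' \<open>y \<noteq> y'\<close> by (simp_all flip: d_def)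
  then have "norm ((1 / 2) *\<^sub>R (?u + ?v)) < 1"
    using assms(1) unfolding strictly_convex_space_def by blast
  also have "(1 / 2) *\<^sub>R (?u + ?v) = (1 / d) *\<^sub>R ((1 / 2) *\<^sub>R ((x - y) + (x - y')))"
    by (simp only: scaleR_add_right scaleR_scaleR mult.commute)
  also have "(1 / 2) *\<^sub>R ((x - y) + (x - y')) = x - m"
  proof -
    have "(1 / 2) *\<^sub>R (x + x) = x"
      by (simp flip: scaleR_2)
    then show ?thesis
      by (simp add: m_def algebra_simps)
  qed
  finally have "norm (x - m) < d"
    using \<open>d > 0\<close> by simp
  moreover have "d \<le> norm (x - m)"
    unfolding d_def m_def using assms(2) y(1) y'(1) by (intro y(2) subspace_scale subspace_add)
  ultimately show False
    by simp
qed

section \<open>Equivariance of the metric projection\<close>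

lemma norm_diff_eq_infdist_iff:
  fixes x :: "'a::real_normed_vector"
  assumes "y \<in> L"
  shows "norm (x - y) = infdist x L \<longleftrightarrow> (\<forall>w\<in>L. norm (x - y) \<le> norm (x - w))"
proof
  assume "norm (x - y) = infdist x L"
  then show "\<forall>w\<in>L. norm (x - y) \<le> norm (x - w)"
    by (simp add: infdist_le flip: dist_norm)
next
  assume "\<forall>w\<in>L. norm (x - y) \<le> norm (x - w)"
  moreover have "L \<noteq> {}"
    using assms by blast
  ultimately have "norm (x - y) \<le> infdist x L"
    unfolding infdist_notempty[OF \<open>L \<noteq> {}\<close>] by (intro cINF_greatest) (auto simp: dist_norm)
  moreover have "infdist x L \<le> norm (x - y)"
    using infdist_le[OF assms] by (simp add: dist_norm)
  ultimately show "norm (x - y) = infdist x L"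
    by simp
qed

lemma metric_projection_eqI:
  fixes x :: "'a::real_normed_vector"
  assumes "strictly_convex_space TYPE('a)" and "subspace L"
    and "y \<in> L" "\<And>w. w \<in> L \<Longrightarrow> norm (x - y) \<le> norm (x - w)"
  shows "metric_projection L x = y"
  unfolding metric_projection_def
proof (rule the_equality)
  show "y \<in> L \<and> norm (x - y) = infdist x L"
    using assms(3,4) by (simp add: norm_diff_eq_infdist_iff)
  fix y' assume "y' \<in> L \<and> norm (x - y') = infdist x L"
  then show "y' = y"
    using nearest_point_unique[OF assms(1,2) _ _ assms(3,4)] norm_diff_eq_infdist_iff by blast
qed

lemma metric_projection_nearest:
  fixes x :: "'a::real_normed_vector"
  assumes "finite_dimensional_space TYPE('a)" and "strictly_convex_space TYPE('a)"
    and "subspace L"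
  shows "metric_projection L x \<in> L"
    and "w \<in> L \<Longrightarrow> norm (x - metric_projection L x) \<le> norm (x - w)"
proof -
  obtain C where C: "finite C" "L = span C"
    using finite_dimensional_subspace_span[OF assms(1,3)] by blast
  obtain y where y: "y \<in> L" "\<And>w. w \<in> L \<Longrightarrow> norm (x - y) \<le> norm (x - w)"
    using nearest_point_exists[of L x] compact_cball_Int_span[OF C(1)] span_zero C(2) by blast
  have "metric_projection L x = y"
    using metric_projection_eqI[OF assms(2,3) y] .
  with y show "metric_projection L x \<in> L"
    and "w \<in> L \<Longrightarrow> norm (x - metric_projection L x) \<le> norm (x - w)"
    by simp_all
qed

lemma metric_projection_affine:
  fixes x z :: "'a::real_normed_vector"
  assumes "finite_dimensional_space TYPE('a)" and "strictly_convex_space TYPE('a)"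
    and "subspace L" and "z \<in> L" and "t > 0"
  shows "metric_projection L (z + t *\<^sub>R x) = z + t *\<^sub>R metric_projection L x"
proof (rule metric_projection_eqI[OF assms(2,3)])
  note nearest = metric_projection_nearest[OF assms(1-3), where x = x]
  show "z + t *\<^sub>R metric_projection L x \<in> L"
    using assms(3,4) nearest(1) by (intro subspace_add subspace_scale)
  fix w assume "w \<in> L"
  have "inverse t *\<^sub>R (w - z) \<in> L"
    using assms(3,4) \<open>w \<in> L\<close> by (intro subspace_scale subspace_diff)
  note le = nearest(2)[OF this]
  have "norm (z + t *\<^sub>R x - (z + t *\<^sub>R metric_projection L x))
      = t * norm (x - metric_projection L x)"
    using assms(5) by (simp flip: scaleR_diff_right)
  also have "\<dots> \<le> t * norm (x - inverse t *\<^sub>R (w - z))"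
    using le assms(5) by (intro mult_left_mono) auto
  also have "\<dots> = norm (t *\<^sub>R (x - inverse t *\<^sub>R (w - z)))"
    using assms(5) by simp
  also have "t *\<^sub>R (x - inverse t *\<^sub>R (w - z)) = z + t *\<^sub>R x - w"
    using assms(5) by (simp add: algebra_simps)
  finally show "norm (z + t *\<^sub>R x - (z + t *\<^sub>R metric_projection L x))
      \<le> norm (z + t *\<^sub>R x - w)" .
qed

lemma alternating_orbit_affine:
  fixes x z :: "'a::real_normed_vector"
  assumes "finite_dimensional_space TYPE('a)" and "strictly_convex_space TYPE('a)"
    and "subspace M" and "subspace N" and "z \<in> M \<inter> N" and "t > 0"
  shows "((metric_projection M \<circ> metric_projection N) ^^ n) (z + t *\<^sub>R x)
       = z + t *\<^sub>R ((metric_projection M \<circ> metric_projection N) ^^ n) x"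
  using assms by (induction n) (simp_all add: metric_projection_affine)

section \<open>Equivariance of the limit\<close>

lemma convergent_affine_iff:
  fixes X :: "nat \<Rightarrow> 'a::real_normed_vector"
  assumes "t \<noteq> 0"
  shows "convergent (\<lambda>n. z + t *\<^sub>R X n) \<longleftrightarrow> convergent X"
proof
  assume "convergent (\<lambda>n. z + t *\<^sub>R X n)"
  then obtain l where "(\<lambda>n. z + t *\<^sub>R X n) \<longlonglongrightarrow> l"
    by (auto simp: convergent_def)
  then have "(\<lambda>n. inverse t *\<^sub>R (z + t *\<^sub>R X n - z)) \<longlonglongrightarrow> inverse t *\<^sub>R (l - z)"
    by (intro tendsto_intros)
  then show "convergent X"
    using assms by (auto simp: convergent_def)
next
  assume "convergent X"
  then obtain l where "X \<longlonglongrightarrow> l"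
    by (auto simp: convergent_def)
  then have "(\<lambda>n. z + t *\<^sub>R X n) \<longlonglongrightarrow> z + t *\<^sub>R l"
    by (intro tendsto_intros)
  then show "convergent (\<lambda>n. z + t *\<^sub>R X n)"
    by (rule convergentI)
qed

lemma lim_affine:
  fixes X :: "nat \<Rightarrow> 'a::real_normed_vector"
  assumes "convergent X"
  shows "lim (\<lambda>n. z + t *\<^sub>R X n) = z + t *\<^sub>R lim X"
  using assms by (intro limI tendsto_intros) (simp add: convergent_LIMSEQ_iff)

text \<open>The limit operator is a definite description, so it has the same value on all divergent
  sequences.\<close>

lemma lim_divergent_eq:
  assumes "\<not> convergent X" and "\<not> convergent Y"
  shows "lim X = lim Y"
proof -
  have "(\<lambda>L. X \<longlonglongrightarrow> L) = (\<lambda>L. Y \<longlonglongrightarrow> L)"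
    using assms by (auto simp: convergent_def)
  then show ?thesis
    by (simp add: lim_def)
qed

theorem proposition2p6:
  fixes M N :: "'a::banach set"
  assumes "finite_dimensional_space TYPE('a)"
    and "strictly_convex_space TYPE('a)"
    and "smooth_space TYPE('a)"
    and "subspace M" and "subspace N"
    and "\<exists>z\<in>M \<inter> N. \<exists>\<epsilon>>0. \<forall>x\<in>cball z \<epsilon>.
           alternating_limit M N x = metric_projection (M \<inter> N) x"
  shows "\<forall>x. alternating_limit M N x = metric_projection (M \<inter> N) x"
proof
  fix x
  obtain z \<epsilon> where z: "z \<in> M \<inter> N" and "\<epsilon> > 0" and
    eq: "\<And>y. y \<in> cball z \<epsilon> \<Longrightarrow> alternating_limit M N y = metric_projection (M \<inter> N) y"
    using assms(6) by blast
  have sub: "subspace (M \<inter> N)"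
    using assms(4,5) by (rule subspace_inter)
  let ?P = "metric_projection (M \<inter> N)"
  define orbit where
    "orbit y = (\<lambda>n. ((metric_projection M \<circ> metric_projection N) ^^ n) y)" for y
  have lim_orbit: "alternating_limit M N y = lim (orbit y)" for y
    by (simp add: alternating_limit_def orbit_def)
  have orbit_affine: "orbit (w + t *\<^sub>R x) = (\<lambda>n. w + t *\<^sub>R orbit x n)"
    if "w \<in> M \<inter> N" "t > 0" for w t
    unfolding orbit_def using alternating_orbit_affine[OF assms(1,2,4,5) that] by blast

  \<comment> \<open>The scale \<open>t\<close> is so small that \<open>z + t x\<close>, and also \<open>(1 + t) z + t x\<close>, lie in the ball.\<close>
  define t where "t = \<epsilon> / (1 + norm z + norm x)"
  have "t > 0"
    using \<open>\<epsilon> > 0\<close> by (simp add: t_def add_pos_nonneg)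
  have "t * (1 + norm z + norm x) = \<epsilon>"
    using norm_ge_zero[of z] norm_ge_zero[of x] unfolding t_def
    by (simp add: add_nonneg_eq_0_iff)
  then have t: "t * norm z + t * norm x \<le> \<epsilon>"
    using \<open>t > 0\<close> by (simp add: algebra_simps)
  have lim_eq: "lim (\<lambda>n. (z + s *\<^sub>R z) + u *\<^sub>R orbit x n) = (z + s *\<^sub>R z) + u *\<^sub>R ?P x"
    if "0 \<le> s" "s \<le> t" "0 < u" "u \<le> t" for s u
  proof -
    have w: "z + s *\<^sub>R z \<in> M \<inter> N"
      using z sub by (intro subspace_add subspace_scale)
    have "norm (s *\<^sub>R z + u *\<^sub>R x) \<le> s * norm z + u * norm x"
      using norm_triangle_ineq[of "s *\<^sub>R z" "u *\<^sub>R x"] that by simp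
    also have "\<dots> \<le> t * norm z + t * norm x"
      using that by (intro add_mono mult_right_mono) auto
    finally have "norm (z - (z + s *\<^sub>R z + u *\<^sub>R x)) \<le> \<epsilon>"
      using t norm_minus_cancel[of "s *\<^sub>R z + u *\<^sub>R x"] by (simp add: algebra_simps)
    then have "z + s *\<^sub>R z + u *\<^sub>R x \<in> cball z \<epsilon>"
      by (simp add: dist_norm)
    then have "lim (orbit (z + s *\<^sub>R z + u *\<^sub>R x)) = ?P (z + s *\<^sub>R z + u *\<^sub>R x)"
      using eq lim_orbit by simp
    then show ?thesis
      using orbit_affine[OF w] metric_projection_affine[OF assms(1,2) sub w] that by simp
  qed

  have "lim (orbit x) = ?P x"
  proof (cases "convergent (orbit x)")
    case True
    then have "z + t *\<^sub>R lim (orbit x) = z + t *\<^sub>R ?P x"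
      using lim_eq[of 0 t] lim_affine[OF True, of z t] \<open>t > 0\<close> by simp
    then show ?thesis
      using \<open>t > 0\<close> by simp
  next
    case False
    have const: "lim (orbit x) = (z + s *\<^sub>R z) + u *\<^sub>R ?P x"
      if "0 \<le> s" "s \<le> t" "0 < u" "u \<le> t" for s u
      using lim_eq[OF that] that False
        lim_divergent_eq[OF False, of "\<lambda>n. (z + s *\<^sub>R z) + u *\<^sub>R orbit x n"]
      by (simp add: convergent_affine_iff)
    have "z + t *\<^sub>R ?P x = z + (t / 2) *\<^sub>R ?P x"
      using const[of 0 t] const[of 0 "t / 2"] \<open>t > 0\<close> by simp
    then have "?P x = 0"
      using \<open>t > 0\<close> by simp
    moreover have "z + t *\<^sub>R ?P x = (z + t *\<^sub>R z) + t *\<^sub>R ?P x"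
      using const[of 0 t] const[of t t] \<open>t > 0\<close> by simp
    then have "z = 0"
      using \<open>t > 0\<close> by simp
    ultimately show ?thesis
      using const[of 0 t] \<open>t > 0\<close> by simp
  qed
  then show "alternating_limit M N x = ?P x"
    by (simp add: lim_orbit)
qed

end
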